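(* Let $\mathbb{F}\in\{\mathbb{R},\mathbb{C}\}$ and let $A=\operatorname{Arrow}(D,u,v,\alpha)\in\mathbb{F}^{n\times n}$ be an arrowhead matrix. If all $d_i\neq 0$, $i=1,\dots,n-1$, then $$ \det(A)=\Big(\prod_{i} d_i\Big)\,(\alpha-v^\star D^{-1}u). $$ If $d_i=0$ for some $i\in\{1,\dots,n-1\}$, then $$ \det(A)=-\Big(\prod_{j=1}^{i-1}d_j\Big)\cdot v_i^\star\cdot\Big(\prod_{j=i+1}^{n-1}d_j\Big)\cdot u_i . $$
   Context: $\star$ denotes the transpose of a real matrix or vector, the conjugate transpose of a complex matrix or vector, and the conjugate of a scalar. Arrowhead matrix: given a diagonal matrix $D$ of order $n-1$ with diagonal elements $d_1,\dots,d_{n-1}\in\mathbb{F}$, vectors $u,v\in\mathbb{F}^{n-1}$ and $\alpha\in\mathbb{F}$, $\operatorname{Arrow}(D,u,v,\alpha)$ is the matrix $\begin{bmatrix} D & u\\ v^\star & \alpha\end{bmatrix}\in\mathbb{F}^{n\times n}$, or any symmetric permutation $Q\begin{bmatrix} D & u\\ v^\star & \alpha\end{bmatrix}Q^T$ of it, with $Q$ a permutation matrix. Empty products equal $1$. *)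

theory Defs
  imports
    "Jordan_Normal_Form.Determinant"
    "Jordan_Normal_Form.Gauss_Jordan_Elimination"
begin

definition is_permutation_mat :: "nat \<Rightarrow> 'a :: {zero,one} mat \<Rightarrow> bool" where
  "is_permutation_mat n Q \<longleftrightarrow>
    (\<exists>p. p permutes {..<n} \<and> Q = mat n n (\<lambda>(i, j). if i = p j then 1 else 0))"

text \<open>The row vector \<open>v\<^sup>\<star>\<close> is \<^term>\<open>mat_of_row (conjugate v)\<close>; on \<^typ>\<open>real\<close>, \<^const>\<open>conjugate\<close> is
  the identity, so this is the plain transpose there.\<close>

definition arrow_block :: "'a :: conjugate mat \<Rightarrow> 'a vec \<Rightarrow> 'a vec \<Rightarrow> 'a \<Rightarrow> 'a mat" where
  "arrow_block D u v \<alpha> =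
    four_block_mat D                            (mat_of_cols (dim_vec u) [u])
                   (mat_of_row (conjugate v))   (mat 1 1 (\<lambda>_. \<alpha>))"

text \<open>\<open>A = Arrow(D,u,v,\<alpha>)\<close> does not determine \<open>A\<close>, since any symmetric permutation of the block
  matrix is allowed; hence a predicate, whose last argument is \<open>A\<close>.\<close>

definition is_arrow ::
  "nat \<Rightarrow> 'a :: conjugatable_field mat \<Rightarrow> 'a vec \<Rightarrow> 'a vec \<Rightarrow> 'a \<Rightarrow> 'a mat \<Rightarrow> bool" where
  "is_arrow n D u v \<alpha> A \<longleftrightarrow>
    n \<ge> 1 \<and> D \<in> carrier_mat (n - 1) (n - 1) \<and> diagonal_mat D \<and>
    u \<in> carrier_vec (n - 1) \<and> v \<in> carrier_vec (n - 1) \<and>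
    (\<exists>Q. is_permutation_mat n Q \<and> A = Q * arrow_block D u v \<alpha> * transpose_mat Q)"

end

theory Submission
  imports Defs
begin

text \<open>The determinant ignores symmetric permutations. If \<open>D\<close> is invertible, one block column operation
  clears \<open>u\<close> and leaves a block triangular matrix. If \<open>d\<^sub>i = 0\<close>, then row \<open>i\<close> and
  column \<open>i\<close> of the block matrix carry only the entries \<open>u\<^sub>i\<close> and \<open>v\<^sub>i\<^sup>\<star>\<close>, and expanding along
  both leaves a diagonal minor.\<close>

text \<open>Both \<open>Q\<close> and its transpose have determinant \<open>signof p\<close>, and
  the square of a sign is 1.\<close>

lemma det_permutation_mat_conj:
  fixes B :: "'a :: comm_ring_1 mat"
  assumes Q: "is_permutation_mat n Q" and B: "B \<in> carrier_mat n n"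
  shows "det (Q * B * transpose_mat Q) = det B"
proof -
  from Q obtain p where p: "p permutes {..<n}"
    and Qp: "Q = mat n n (\<lambda>(i, j). if i = p j then 1 else 0)"
    unfolding is_permutation_mat_def by blast
  have p': "p permutes {0..<n}" using p by (simp add: atLeast0LessThan)
  have QC: "Q \<in> carrier_mat n n" using Qp by simp
  \<comment> \<open>The transpose, not \<open>Q\<close> itself, is the identity with rows permuted
    by \<open>p\<close>; for \<open>Q\<close> the inverse permutation would appear.\<close>
  have "transpose_mat Q = mat n n (\<lambda>(i, j). 1\<^sub>m n $$ (p i, j))"
    using permutes_in_image[OF p] by (intro eq_matI) (auto simp: Qp)
  then have dT: "det (transpose_mat Q) = signof p"
    using det_permute_rows[OF one_carrier_mat p', where 'a = 'a] by simp
  then have d: "det Q = signof p"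
    using det_transpose[OF QC] by simp
  have "det (Q * B * transpose_mat Q) = det Q * det B * det (transpose_mat Q)"
    using QC B by (simp add: det_mult[of _ n])
  also have "\<dots> = det B"
    unfolding dT d by (simp add: sign_def)
  finally show ?thesis .
qed

lemma det_diagonal_mat:
  assumes "D \<in> carrier_mat m m" and "diagonal_mat D"
  shows "det D = (\<Prod>i<m. D $$ (i, i))"
proof -
  have "upper_triangular D" using assms unfolding diagonal_mat_def by auto
  then show ?thesis
    using det_upper_triangular[OF _ assms(1)] assms(1)
    by (simp add: prod_list_diag_prod atLeast0LessThan)
qed

text \<open>\<open>mat_inverse\<close> returns an option; a nonzero determinant makes
  \<open>D\<close> a unit of the matrix ring, which excludes \<open>None\<close>, so
  \<open>the\<close> yields the true inverse.\<close>

lemma mat_inverse_of_det_nonzero: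
  fixes D :: "'a :: field mat"
  assumes D: "D \<in> carrier_mat m m" and "det D \<noteq> 0"
  shows "D * the (mat_inverse D) = 1\<^sub>m m" and "the (mat_inverse D) \<in> carrier_mat m m"
proof -
  have "D \<in> Units (ring_mat TYPE('a) m ())"
    using det_non_zero_imp_unit[OF D assms(2)] .
  then obtain B where "mat_inverse D = Some B"
    using mat_inverse(1)[OF D] by fastforce
  then show "D * the (mat_inverse D) = 1\<^sub>m m" "the (mat_inverse D) \<in> carrier_mat m m"
    using mat_inverse(2)[OF D] by simp_all
qed

lemma arrow_block_carrier:
  assumes "D \<in> carrier_mat m m"
  shows "arrow_block D u v \<alpha> \<in> carrier_mat (Suc m) (Suc m)"
  unfolding arrow_block_def using four_block_carrier_mat[OF assms, of "mat 1 1 (\<lambda>_. \<alpha>)" 1 1] by simp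

lemma arrow_block_index:
  fixes v :: "'a :: conjugate vec"
  assumes "D \<in> carrier_mat m m" "u \<in> carrier_vec m" "v \<in> carrier_vec m"
    and "i < Suc m" "j < Suc m"
  shows "arrow_block D u v \<alpha> $$ (i, j) =
    (if i < m then if j < m then D $$ (i, j) else u $ i
     else if j < m then conjugate (v $ j) else \<alpha>)"
  using assms unfolding arrow_block_def
  by (auto simp: mat_of_cols_def mat_of_row_def)

text \<open>The vector \<open>w\<close> plays the part of D^{-1} u. Subtracting from the last column
  the combination of the first \<open>m\<close> columns with coefficients \<open>w\<close> turns
  \<open>u\<close> into 0 and \<alpha> into the Schur complement of \<open>D\<close>.\<close>

lemma det_arrow_block_invertible:
  fixes D :: "'a :: conjugatable_field mat"
  assumes D: "D \<in> carrier_mat m m" and u: "u \<in> carrier_vec m" and v: "v \<in> carrier_vec m"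
    and w: "w \<in> carrier_vec m" and Dw: "D *\<^sub>v w = u"
  shows "det (arrow_block D u v \<alpha>) = det D * (\<alpha> - conjugate v \<bullet> w)"
proof -
  let ?W = "mat_of_cols m [w]" and ?V = "mat_of_row (conjugate v)" and ?U = "mat_of_cols m [u]"
  let ?a = "mat 1 1 (\<lambda>_. \<alpha>) :: 'a mat"
  \<comment> \<open>\<open>?E\<close> encodes this column operation; it is unit upper triangular, so
    it leaves the determinant unchanged.\<close>
  let ?E = "four_block_mat (1\<^sub>m m) (- ?W) (0\<^sub>m 1 m) (1\<^sub>m 1)"
  let ?s = "mat 1 1 (\<lambda>_. \<alpha> - conjugate v \<bullet> w) :: 'a mat"
  have V: "?V \<in> carrier_mat 1 m" using v by simp
  have W: "?W \<in> carrier_mat m 1" and U: "?U \<in> carrier_mat m 1"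
    using mat_of_cols_carrier(1)[of m "[w]"] mat_of_cols_carrier(1)[of m "[u]"] by simp_all
  have A: "arrow_block D u v \<alpha> = four_block_mat D ?U ?V ?a"
    using u by (simp add: arrow_block_def)
  have DW: "D * - ?W + ?U = 0\<^sub>m m 1"
  proof (rule eq_matI)
    fix i j assume ij: "i < dim_row (0\<^sub>m m 1 :: 'a mat)" "j < dim_col (0\<^sub>m m 1 :: 'a mat)"
    have "u $ i = row D i \<bullet> w" using ij D Dw by auto
    moreover have "(D * - ?W) $$ (i, j) = - (row D i \<bullet> w)"
      using ij D w W by (simp add: uminus_scalar_prod col_uminus)
    ultimately show "(D * - ?W + ?U) $$ (i, j) = 0\<^sub>m m 1 $$ (i, j)"
      using ij D by (simp add: mat_of_cols_def)
  qed (use D in auto)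
  have VW: "?V * - ?W + ?a = ?s"
  proof (rule eq_matI)
    fix i j assume ij: "i < dim_row ?s" "j < dim_col ?s"
    have "(?V * - ?W) $$ (i, j) = - (conjugate v \<bullet> w)"
      using ij w v W by (simp add: uminus_scalar_prod col_uminus)
    then show "(?V * - ?W + ?a) $$ (i, j) = ?s $$ (i, j)" using ij by simp
  qed auto
  have "arrow_block D u v \<alpha> * ?E =
      four_block_mat (D * 1\<^sub>m m + ?U * 0\<^sub>m 1 m) (D * - ?W + ?U * 1\<^sub>m 1)
        (?V * 1\<^sub>m m + ?a * 0\<^sub>m 1 m) (?V * - ?W + ?a * 1\<^sub>m 1)"
    unfolding A by (rule mult_four_block_mat[OF D U V]) (use W in auto)
  also have "\<dots> = four_block_mat D (0\<^sub>m m 1) ?V ?s"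
    using D U right_mult_one_mat[OF V] right_add_zero_mat[OF V] DW VW by simp
  finally have "det (arrow_block D u v \<alpha> * ?E) = det D * det ?s"
    using det_four_block_mat_upper_right_zero[OF D refl V, of ?s] by simp
  moreover have "det ?s = \<alpha> - conjugate v \<bullet> w"
    by (subst det_single) auto
  moreover have "det ?E = 1"
    by (subst det_four_block_mat_lower_left_zero[of _ m _ 1]) (use W in auto)
  moreover have "det (arrow_block D u v \<alpha> * ?E) = det (arrow_block D u v \<alpha>) * det ?E"
    by (rule det_mult[of _ "Suc m"]) (use arrow_block_carrier[OF D] in auto)
  ultimately show ?thesis by simp
qed

text \<open>Two Laplace expansions, along row \<open>i\<close> and then along column
  \<open>i\<close>, have one surviving term each.\<close>

lemma det_arrow_block_zero:
  fixes D :: "'a :: conjugatable_field mat"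
  assumes D: "D \<in> carrier_mat m m" and diag: "diagonal_mat D"
    and u: "u \<in> carrier_vec m" and v: "v \<in> carrier_vec m"
    and i: "i < m" and Di: "D $$ (i, i) = 0"
  shows "det (arrow_block D u v \<alpha>) =
    - ((\<Prod>j<i. D $$ (j, j)) * conjugate (v $ i) * (\<Prod>j\<in>{i<..<m}. D $$ (j, j)) * u $ i)"
proof -
  obtain k where m: "m = Suc k" using i by (cases m) auto
  define A where "A = arrow_block D u v \<alpha>"
  \<comment> \<open>\<open>M\<close> omits the row and column of the entry \<open>u $ i\<close> of
    \<open>A\<close>. Its last row, of index \<open>k\<close>, comes from row \<open>m\<close> of
    \<open>A\<close>, so \<open>N\<close> omits the row and column of the conjugate of
    \<open>v $ i\<close>.\<close>
  define M where "M = mat_delete A i m"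
  define N where "N = mat_delete M k i"
  have A: "A \<in> carrier_mat (Suc m) (Suc m)"
    unfolding A_def by (rule arrow_block_carrier[OF D])
  have M: "M \<in> carrier_mat m m" using mat_delete_carrier[OF A] by (simp add: M_def)
  have N: "N \<in> carrier_mat k k" using mat_delete_carrier[OF M] m by (simp add: N_def)
  note Aij = arrow_block_index[OF D u v, of _ _ \<alpha>, folded A_def]
  have D0: "D $$ (a, b) = 0" if "a < m" "b < m" "a \<noteq> b" for a b
    using diag D that by (auto simp: diagonal_mat_def)
  have Di0: "D $$ (i, b) = 0" if "b < m" for b
    using D0[OF i that] Di by (cases "i = b") auto
  have Mij: "M $$ (a, b) = A $$ (if a < i then a else Suc a, b)" if "a < m" "b < m" for a b
    using that A by (simp add: M_def mat_delete_def)
  \<comment> \<open>The diagonal entry of column \<open>i\<close> went away with row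
    \<open>i\<close>, so above the last row this column holds only off-diagonal entries of
    \<open>D\<close>.\<close>
  have M0: "M $$ (a, i) = 0" if "a < m" "a \<noteq> k" for a
    using that i m by (auto simp: Mij Aij intro!: D0)
  \<comment> \<open>\<open>N\<close> is \<open>D\<close> without its row and column
    \<open>i\<close>, hence again diagonal.\<close>
  have Nij: "N $$ (a, b) = D $$ (if a < i then a else Suc a, if b < i then b else Suc b)"
    if "a < k" "b < k" for a b
    using that M m i by (simp add: N_def mat_delete_def Mij Aij)
  have "det A = (\<Sum>j<Suc m. A $$ (i, j) * cofactor A i j)"
    by (rule laplace_expansion_row[OF A]) (use i in simp)
  also have "\<dots> = A $$ (i, m) * cofactor A i m"
    by (subst sum.remove[of _ m]) (use i in \<open>auto intro!: sum.neutral simp: Aij Di0\<close>)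
  also have "\<dots> = u $ i * ((-1) ^ (i + m) * det M)"
    using i by (simp add: Aij cofactor_def M_def)
  finally have dA: "det A = u $ i * ((-1) ^ (i + m) * det M)" .
  have "det M = (\<Sum>r<m. M $$ (r, i) * cofactor M r i)"
    by (rule laplace_expansion_column[OF M i])
  also have "\<dots> = M $$ (k, i) * cofactor M k i"
    by (subst sum.remove[of _ k]) (auto intro!: sum.neutral simp: m M0)
  also have "\<dots> = conjugate (v $ i) * ((-1) ^ (k + i) * det N)"
    using i m by (simp add: Mij Aij cofactor_def N_def)
  finally have dM: "det M = conjugate (v $ i) * ((-1) ^ (k + i) * det N)" .
  have "det N = (\<Prod>j<k. N $$ (j, j))"
    by (rule det_diagonal_mat[OF N]) (use N i m in \<open>auto simp: diagonal_mat_def Nij intro!: D0\<close>)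
  \<comment> \<open>From position \<open>i\<close> on, the diagonal of \<open>N\<close> is that of
    \<open>D\<close> shifted by one, so the product skips the entry at \<open>i\<close>.\<close>
  also have "\<dots> = (\<Prod>j<i. N $$ (j, j)) * (\<Prod>j\<in>{i..<k}. N $$ (j, j))"
    using i m by (subst prod.union_disjoint[symmetric]) (auto intro!: prod.cong)
  also have "(\<Prod>j<i. N $$ (j, j)) = (\<Prod>j<i. D $$ (j, j))"
    using i m by (intro prod.cong) (auto simp: Nij)
  also have "(\<Prod>j\<in>{i..<k}. N $$ (j, j)) = (\<Prod>j\<in>{i<..<m}. D $$ (j, j))"
    by (rule prod.reindex_bij_witness[of _ "\<lambda>j. j - 1" Suc]) (auto simp: m Nij)
  finally have dN: "det N = (\<Prod>j<i. D $$ (j, j)) * (\<Prod>j\<in>{i<..<m}. D $$ (j, j))" .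
  \<comment> \<open>Since \<open>m = Suc k\<close>, the exponents add up to the odd number 2i + 2k +
    1; this is the minus sign of the formula.\<close>
  have sgn: "(-1) ^ (i + m) * (-1) ^ (k + i) = (-1 :: 'a)"
    unfolding m by (simp add: minus_one_power_iff)
  have "det A = ((-1) ^ (i + m) * (-1) ^ (k + i)) * (u $ i * conjugate (v $ i) * det N)"
    unfolding dA dM by (simp add: mult_ac)
  then show ?thesis
    unfolding sgn dN A_def by (simp add: mult_ac)
qed

text \<open>Working over \<open>conjugatable_field\<close> covers the real and the complex case by
  one argument.\<close>

lemma det_is_arrow:
  fixes D :: "'a :: conjugatable_field mat"
  assumes "is_arrow n D u v \<alpha> A"
  shows "(\<forall>i<n - 1. D $$ (i, i) \<noteq> 0) \<Longrightarrow>
      det A = (\<Prod>i<n - 1. D $$ (i, i)) * (\<alpha> - conjugate v \<bullet> (the (mat_inverse D) *\<^sub>v u))"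
    and "i < n - 1 \<Longrightarrow> D $$ (i, i) = 0 \<Longrightarrow>
      det A = - ((\<Prod>j<i. D $$ (j, j)) * conjugate (v $ i)
        * (\<Prod>j\<in>{i<..<n - 1}. D $$ (j, j)) * u $ i)"
proof -
  define m where "m = n - 1"
  from assms obtain Q where n: "n = Suc m" and D: "D \<in> carrier_mat m m"
    and diag: "diagonal_mat D" and u: "u \<in> carrier_vec m" and v: "v \<in> carrier_vec m"
    and Q: "is_permutation_mat n Q" and A: "A = Q * arrow_block D u v \<alpha> * transpose_mat Q"
    by (auto simp: is_arrow_def m_def)
  have dA: "det A = det (arrow_block D u v \<alpha>)"
    unfolding A by (rule det_permutation_mat_conj[OF Q]) (use arrow_block_carrier[OF D] n in simp)
  have dD: "det D = (\<Prod>i<m. D $$ (i, i))" by (rule det_diagonal_mat[OF D diag])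
  show "det A = (\<Prod>i<n - 1. D $$ (i, i)) * (\<alpha> - conjugate v \<bullet> (the (mat_inverse D) *\<^sub>v u))"
    if "\<forall>i<n - 1. D $$ (i, i) \<noteq> 0"
  proof -
    have "det D \<noteq> 0" using that dD by (simp add: m_def)
    note inv = mat_inverse_of_det_nonzero[OF D this]
    \<comment> \<open>This supplies the vector \<open>w\<close> of the block elimination.\<close>
    have "D *\<^sub>v (the (mat_inverse D) *\<^sub>v u) = u"
      using assoc_mult_mat_vec[OF D inv(2) u] inv(1) u by simp
    from det_arrow_block_invertible[OF D u v _ this] inv(2) u
    show ?thesis by (simp add: dA dD m_def)
  qed
  show "det A = - ((\<Prod>j<i. D $$ (j, j)) * conjugate (v $ i)
        * (\<Prod>j\<in>{i<..<n - 1}. D $$ (j, j)) * u $ i)"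
    if "i < n - 1" "D $$ (i, i) = 0"
    using det_arrow_block_zero[OF D diag u v] that dA by (simp add: m_def)
qed

(* The two conjuncts are the cases of real and complex scalars.  Matrix and vector indices
   start at 0, so the i-th diagonal element of D is D $$ (i - 1, i - 1). *)
theorem lemma2:
  shows
    "(\<forall>n (D :: real mat) u v \<alpha> A. is_arrow n D u v \<alpha> A \<longrightarrow>
       ((\<forall>i<n - 1. D $$ (i, i) \<noteq> 0) \<longrightarrow>
          det A = (\<Prod>i<n - 1. D $$ (i, i))
                    * (\<alpha> - conjugate v \<bullet> (the (mat_inverse D) *\<^sub>v u))) \<and>
       (\<forall>i<n - 1. D $$ (i, i) = 0 \<longrightarrow>
          det A = - ((\<Prod>j<i. D $$ (j, j)) * conjugate (v $ i)
                     * (\<Prod>j\<in>{i<..<n - 1}. D $$ (j, j)) * (u $ i))))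
     \<and>
     (\<forall>n (D :: complex mat) u v \<alpha> A. is_arrow n D u v \<alpha> A \<longrightarrow>
       ((\<forall>i<n - 1. D $$ (i, i) \<noteq> 0) \<longrightarrow>
          det A = (\<Prod>i<n - 1. D $$ (i, i))
                    * (\<alpha> - conjugate v \<bullet> (the (mat_inverse D) *\<^sub>v u))) \<and>
       (\<forall>i<n - 1. D $$ (i, i) = 0 \<longrightarrow>
          det A = - ((\<Prod>j<i. D $$ (j, j)) * conjugate (v $ i)
                     * (\<Prod>j\<in>{i<..<n - 1}. D $$ (j, j)) * (u $ i))))"
  by (intro conjI allI impI; rule det_is_arrow; assumption)

end
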